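(* Let $n$ be a positive integer and let $A=(a_{ij})_{1\le i\le n,\,1\le j\le 2n}$ be an $n\times 2n$ matrix such that the entries $a_{ij}$ with $1\le i\le n$ and $1\le j\le 2i-1$ are generic integers, and all the remaining entries are $0$. Let $v_1,\dots,v_{2n}$ be the columns of $A$. Then the vector matroid (over $\mathbb{Q}$) of $v_1,\dots,v_{2n}$ is isomorphic to the Catalan matroid $\mathbf{C}_n$.
   Context: Generic: given real numbers $x_1,\dots,x_k$, let $x_S=\prod_{i\in S}x_i$ for each $S\subseteq[k]=\{1,\dots,k\}$ (with $x_\emptyset=1$). Form all $2^{2^k}$ possible sums of some of the $x_S$'s, i.e. the sums $\sum_{S\in\mathcal{F}}x_S$ over all families $\mathcal{F}$ of subsets of $[k]$. The collection $x_1,\dots,x_k$ is called generic if these $2^{2^k}$ sums are all distinct. "Generic integers" means that the whole collection of entries $a_{ij}$ ($1\le i\le n$, $1\le j\le 2i-1$) consists of integers and is generic. The vector matroid of an indexed family of vectors is the matroid on the index set whose independent sets are the index sets of linearly independent subfamilies. A Dyck path of length $2n$ is a path in the plane from $(0,0)$ to $(2n,0)$, with steps $(1,1)$ (up-steps) and $(1,-1)$ (down-steps), that never passes below the $x$-axis; its up-step set is the set of $i\in[2n]$ for which the $i$-th step is an up-step. The Catalan matroid $\mathbf{C}_n$ is the matroid on the ground set $[2n]$ whose bases are the up-step sets of all Dyck paths of length $2n$. *)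

theory Defs
  imports Complex_Main "HOL-Library.Product_Plus" "Jordan_Normal_Form.VS_Connect"
begin

section \<open>Matroids\<close>

text \<open>A matroid is given by its ground set and its family of independent sets.\<close>

locale matroid =
  fixes E :: "'a set" and indep :: "'a set \<Rightarrow> bool"
  assumes finite_ground: "finite E"
    and indep_subset_ground: "indep X \<Longrightarrow> X \<subseteq> E"
    and indep_empty: "indep {}"
    and indep_subset: "indep X \<Longrightarrow> Y \<subseteq> X \<Longrightarrow> indep Y"
    and augment: "indep X \<Longrightarrow> indep Y \<Longrightarrow> card X < card Y \<Longrightarrow> \<exists>y\<in>Y - X. indep (insert y X)"
begin

definition basis :: "'a set \<Rightarrow> bool" where
  "basis B \<longleftrightarrow> indep B \<and> (\<forall>X. indep X \<longrightarrow> B \<subseteq> X \<longrightarrow> X = B)"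

end

locale matroid_isomorphism = M: matroid E I + N: matroid F J
  for E :: "'a set" and I :: "'a set \<Rightarrow> bool" and F :: "'b set" and J :: "'b set \<Rightarrow> bool" +
  fixes f :: "'a \<Rightarrow> 'b"
  assumes bij: "bij_betw f E F"
    and indep_iff: "X \<subseteq> E \<Longrightarrow> I X \<longleftrightarrow> J (f ` X)"

definition matroids_isomorphic ::
    "'a set \<Rightarrow> ('a set \<Rightarrow> bool) \<Rightarrow> 'b set \<Rightarrow> ('b set \<Rightarrow> bool) \<Rightarrow> bool" where
  "matroids_isomorphic E I F J \<longleftrightarrow> (\<exists>f. matroid_isomorphism E I F J f)"


section \<open>Vector matroids\<close>

text \<open>Independent sets of the vector matroid of the family \<open>(v j)\<close> (\<open>j \<in> E\<close>) of vectors of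
  length \<open>n\<close>. Since \<^const>\<open>module.lin_dep\<close> speaks about sets of vectors, injectivity is
  needed to express linear independence of the subfamily: repeated vectors are dependent.\<close>

definition vector_indep :: "nat \<Rightarrow> 'i set \<Rightarrow> ('i \<Rightarrow> 'k :: field vec) \<Rightarrow> 'i set \<Rightarrow> bool" where
  "vector_indep n E v X \<longleftrightarrow>
     X \<subseteq> E \<and> inj_on v X \<and> \<not> module.lin_dep class_ring (module_vec TYPE('k) n) (v ` X)"

lemma matroid_vector_indep:
  fixes v :: "'i \<Rightarrow> 'k :: field vec"
  assumes finE: "finite E" and v: "v ` E \<subseteq> carrier_vec n"
  shows "matroid E (vector_indep n E v)"
proof -
  interpret vec_space "TYPE('k)" n .
  show ?thesis
  proof
    show "finite E" by (rule finE)
    show "X \<subseteq> E" if "vector_indep n E v X" for X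
      using that by (simp add: vector_indep_def)
    show "vector_indep n E v {}"
      by (auto simp: vector_indep_def lin_dep_def)
    show "vector_indep n E v Y" if "vector_indep n E v X" "Y \<subseteq> X" for X Y
      using that subset_li_is_li[of "v ` X" "v ` Y"] inj_on_subset[of v X Y]
      by (auto simp: vector_indep_def image_mono)
    show "\<exists>y\<in>Y - X. vector_indep n E v (insert y X)"
      if X: "vector_indep n E v X" and Y: "vector_indep n E v Y" and less: "card X < card Y" for X Y
    proof (rule ccontr)
      assume neg: "\<not> ?thesis"
      have XE: "X \<subseteq> E" "inj_on v X" "lin_indpt (v ` X)"
        and YE: "Y \<subseteq> E" "inj_on v Y" "lin_indpt (v ` Y)"
        using X Y by (auto simp: vector_indep_def)
      have vX: "v ` X \<subseteq> carrier_vec n" and vY: "v ` Y \<subseteq> carrier_vec n"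
        using XE YE v by auto
      have fins: "finite (v ` X)" "finite (v ` Y)"
        using XE YE finE finite_subset by blast+
      have "v y \<in> span (v ` X)" if y: "y \<in> Y" for y
      proof (cases "v y \<in> v ` X")
        case True
        then show ?thesis using in_own_span[of "v ` X"] vX by auto
      next
        case False
        then have "y \<in> Y - X" using y by auto
        then have nind: "\<not> vector_indep n E v (insert y X)" using neg by blast
        have "lin_dep (v ` X \<union> {v y})"
          using nind False XE YE y by (auto simp: vector_indep_def)
        then show ?thesis
          using lin_dep_iff_in_span[of "v ` X" "v y"] vX vY XE(3) y False by auto
      qed
      then have "v ` Y \<subseteq> span (v ` X)" by auto
      then have "card (v ` Y) \<le> card (v ` X)"
        using replacement[of "v ` Y" "v ` X"] fins vX YE(3) by force
      then show False using less XE(2) YE(2) by (simp add: card_image)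
    qed
  qed
qed


section \<open>Generic collections\<close>

text \<open>The collection \<open>(x i)\<close> is indexed by an arbitrary finite set \<open>K\<close> instead of
  \<open>{1, \<dots>, k}\<close>; the families \<open>\<F>\<close> of subsets of \<open>K\<close> are the elements of \<open>Pow (Pow K)\<close>.\<close>

definition generic :: "'i set \<Rightarrow> ('i \<Rightarrow> real) \<Rightarrow> bool" where
  "generic K x \<longleftrightarrow> inj_on (\<lambda>\<F>. \<Sum>S\<in>\<F>. \<Prod>i\<in>S. x i) (Pow (Pow K))"


section \<open>Dyck paths and the Catalan matroid\<close>

text \<open>A lattice path starting at the origin is represented by the list \<open>w\<close> of its step vectors,
  so that \<open>sum_list (take k w)\<close> is the point reached after \<open>k\<close> steps. The length \<open>2 * n\<close> is the
  horizontal extent, which for these steps is the number of steps. As the steps are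
  straight, it suffices to compare the lattice points of the path with the horizontal axis.\<close>

definition dyck_path :: "nat \<Rightarrow> (int \<times> int) list \<Rightarrow> bool" where
  "dyck_path n w \<longleftrightarrow>
     set w \<subseteq> {(1, 1), (1, -1)} \<and> sum_list w = (2 * int n, 0) \<and>
     (\<forall>k\<le>length w. snd (sum_list (take k w)) \<ge> 0)"

text \<open>Steps are numbered from 1. The Catalan matroid is presented by its independent sets, which
  are the subsets of its bases, the up-step sets of Dyck paths; \<open>matroid_catalan_indep\<close> and
  \<open>basis_catalan_iff\<close> below confirm that this is a matroid with exactly these bases.\<close>

definition up_steps :: "(int \<times> int) list \<Rightarrow> nat set" where
  "up_steps w = {i \<in> {1..length w}. w ! (i - 1) = (1, 1)}"

definition catalan_indep :: "nat \<Rightarrow> nat set \<Rightarrow> bool" where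
  "catalan_indep n X \<longleftrightarrow> (\<exists>w. dyck_path n w \<and> X \<subseteq> up_steps w)"

lemma finite_up_steps: "finite (up_steps w)"
  by (simp add: up_steps_def)

lemma up_steps_snoc:
  "up_steps (w @ [s]) = (if s = (1, 1) then insert (Suc (length w)) (up_steps w) else up_steps w)"
proof -
  have "i \<in> up_steps (w @ [s]) \<longleftrightarrow>
      i \<in> (if s = (1, 1) then insert (Suc (length w)) (up_steps w) else up_steps w)" for i
    by (cases "i = Suc (length w)") (auto simp: up_steps_def nth_append)
  then show ?thesis by blast
qed

lemma sum_list_steps:
  assumes "set w \<subseteq> {(1, 1), (1, -1)}"
  shows "sum_list w = (int (length w), 2 * int (card (up_steps w)) - int (length w))"
  using assms
proof (induction w rule: rev_induct)
  case Nil
  then show ?case by (simp add: up_steps_def zero_prod_def)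
next
  case (snoc s w)
  have "Suc (length w) \<notin> up_steps w" by (simp add: up_steps_def)
  moreover have "s = (1, 1) \<or> s = (1, -1)" using snoc.prems by auto
  ultimately show ?case
    using snoc finite_up_steps[of w] by (auto simp: up_steps_snoc)
qed

lemma up_steps_take: "k \<le> length w \<Longrightarrow> up_steps (take k w) = up_steps w \<inter> {1..k}"
  by (auto simp: up_steps_def)

lemma dyck_path_iff:
  "dyck_path n w \<longleftrightarrow> set w \<subseteq> {(1, 1), (1, -1)} \<and> length w = 2 * n \<and> card (up_steps w) = n \<and>
     (\<forall>k\<le>2 * n. k \<le> 2 * card (up_steps w \<inter> {1..k}))"
proof (cases "set w \<subseteq> {(1, 1), (1, -1)}")
  case True
  have eq: "snd (sum_list (take k w)) = 2 * int (card (up_steps w \<inter> {1..k})) - int k"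
    if "k \<le> length w" for k
    using sum_list_steps[of "take k w"] True set_take_subset[of k w] that
    by (auto simp: up_steps_take)
  have "snd (sum_list (take k w)) \<ge> 0 \<longleftrightarrow> k \<le> 2 * card (up_steps w \<inter> {1..k})"
    if "k \<le> length w" for k
    unfolding eq[OF that] by linarith
  then have "(\<forall>k\<le>length w. snd (sum_list (take k w)) \<ge> 0) \<longleftrightarrow>
      (\<forall>k\<le>length w. k \<le> 2 * card (up_steps w \<inter> {1..k}))"
    by blast
  then show ?thesis
    using True sum_list_steps[OF True] by (auto simp: dyck_path_def)
qed (simp add: dyck_path_def)

lemma ex_path_up_steps:
  assumes "B \<subseteq> {1..m}"
  shows "\<exists>w. set w \<subseteq> {(1, 1), (1, -1)} \<and> length w = m \<and> up_steps w = B"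
proof -
  let ?w = "map (\<lambda>i. if Suc i \<in> B then (1, 1) else (1, -1 :: int)) [0..<m] :: (int \<times> int) list"
  have "i \<in> up_steps ?w \<longleftrightarrow> i \<in> B" for i
    using assms by (cases i) (auto simp: up_steps_def split: if_splits)
  then have "up_steps ?w = B" by blast
  then show ?thesis by (intro exI[of _ ?w]) auto
qed

definition suffix_bounded :: "nat \<Rightarrow> nat set \<Rightarrow> bool" where
  "suffix_bounded n X \<longleftrightarrow> X \<subseteq> {1..2 * n} \<and> (\<forall>k\<le>2 * n. 2 * card (X \<inter> {k<..}) \<le> 2 * n - k)"

lemma card_split: "finite X \<Longrightarrow> X \<subseteq> {1..} \<Longrightarrow> card X = card (X \<inter> {1..k}) + card (X \<inter> {k<..})"
  for X :: "nat set"
  by (subst card_Un_disjoint[symmetric]) (auto intro!: arg_cong[of _ _ card])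

lemma suffix_bounded_subset:
  assumes "suffix_bounded n Y" "X \<subseteq> Y"
  shows "suffix_bounded n X"
proof -
  have "finite Y" using assms by (auto simp: suffix_bounded_def intro: finite_subset)
  then have "card (X \<inter> {k<..}) \<le> card (Y \<inter> {k<..})" for k
    using assms by (intro card_mono) auto
  then show ?thesis
    using assms unfolding suffix_bounded_def by (meson le_trans mult_le_mono2 subset_trans)
qed

lemma suffix_bounded_augment:
  assumes X: "suffix_bounded n X" and Y: "suffix_bounded n Y" and less: "card X < card Y"
  shows "\<exists>y\<in>Y - X. suffix_bounded n (insert y X)"
proof -
  have XY: "X \<subseteq> {1..2 * n}" "Y \<subseteq> {1..2 * n}"
    and bX: "\<And>k. k \<le> 2 * n \<Longrightarrow> 2 * card (X \<inter> {k<..}) \<le> 2 * n - k"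
    and bY: "\<And>k. k \<le> 2 * n \<Longrightarrow> 2 * card (Y \<inter> {k<..}) \<le> 2 * n - k"
    using X Y by (auto simp: suffix_bounded_def)
  have fin: "finite X" "finite Y" using XY finite_subset by blast+
  define tight where "tight k \<longleftrightarrow> k \<le> 2 * n \<and> 2 * n - k < 2 * card (X \<inter> {k<..}) + 2" for k
  have "tight (2 * n)" by (simp add: tight_def)
  define t where "t = (LEAST k. tight k)"
  have t: "tight t" unfolding t_def using \<open>tight (2 * n)\<close> by (rule LeastI)
  have t_le: "t \<le> k" if "tight k" for k unfolding t_def using that by (rule Least_le)
  have "card (Y \<inter> {t<..}) \<le> card (X \<inter> {t<..})"
    using t bY[of t] by (simp add: tight_def)
  moreover have "card X = card (X \<inter> {1..t}) + card (X \<inter> {t<..})"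
    "card Y = card (Y \<inter> {1..t}) + card (Y \<inter> {t<..})"
    by (rule card_split; use fin XY in auto)+
  ultimately have "card (X \<inter> {1..t}) < card (Y \<inter> {1..t})" using less by linarith
  then have "\<not> Y \<inter> {1..t} \<subseteq> X \<inter> {1..t}"
    using card_mono[of "X \<inter> {1..t}" "Y \<inter> {1..t}"] fin by auto
  then obtain y where "y \<in> Y" "y \<notin> X" "y \<in> {1..t}" by blast
  then have y: "y \<in> Y" "y \<notin> X" "1 \<le> y" "y \<le> t" by auto
  have "2 * card (insert y X \<inter> {k<..}) \<le> 2 * n - k" if k: "k \<le> 2 * n" for k
  proof (cases "k < y")
    case True
    then have "\<not> tight k" using t_le[of k] y by auto
    moreover have "insert y X \<inter> {k<..} = insert y (X \<inter> {k<..})" using True by auto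
    ultimately show ?thesis using k y fin by (auto simp: tight_def)
  next
    case False
    then have "insert y X \<inter> {k<..} = X \<inter> {k<..}" by auto
    then show ?thesis using bX[OF k] by simp
  qed
  then have "suffix_bounded n (insert y X)"
    using XY y by (auto simp: suffix_bounded_def)
  then show ?thesis using y by blast
qed

lemma suffix_bounded_extend:
  assumes "suffix_bounded n X"
  shows "\<exists>B. X \<subseteq> B \<and> suffix_bounded n B \<and> card B = n"
  using assms
proof (induction "n - card X" arbitrary: X)
  case 0
  have "2 * card (X \<inter> {0<..}) \<le> 2 * n" and "X \<inter> {0<..} = X"
    using "0.prems" by (auto simp: suffix_bounded_def)
  then show ?case using 0 by auto
next
  case (Suc m)
  have "suffix_bounded n {1..n}"
  proof -
    have "{1..n} \<inter> {k<..} = {Suc k..n}" for k by auto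
    then show ?thesis by (auto simp: suffix_bounded_def)
  qed
  moreover have "card X < card {1..n}" using Suc.hyps(2) by simp
  ultimately obtain y where y: "y \<in> {1..n} - X" "suffix_bounded n (insert y X)"
    using suffix_bounded_augment Suc.prems by blast
  have "finite X" using Suc.prems by (auto simp: suffix_bounded_def intro: finite_subset)
  then have "m = n - card (insert y X)" using y Suc.hyps(2) by simp
  then show ?case using Suc.hyps(1)[of "insert y X"] y by blast
qed

lemma catalan_indep_iff: "catalan_indep n X \<longleftrightarrow> suffix_bounded n X"
proof
  assume "catalan_indep n X"
  then obtain w where w: "dyck_path n w" "X \<subseteq> up_steps w" by (auto simp: catalan_indep_def)
  let ?B = "up_steps w"
  have "length w = 2 * n" "card ?B = n" "\<And>k. k \<le> 2 * n \<Longrightarrow> k \<le> 2 * card (?B \<inter> {1..k})"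
    using w by (auto simp: dyck_path_iff)
  moreover have "card ?B = card (?B \<inter> {1..k}) + card (?B \<inter> {k<..})" for k
    by (rule card_split[OF finite_up_steps]) (auto simp: up_steps_def)
  ultimately have "suffix_bounded n ?B"
    unfolding suffix_bounded_def
    by (smt (verit) Nat.le_diff_conv2 add.commute add_mono_thms_linordered_semiring(3)
        distrib_left_numeral mem_Collect_eq subsetI up_steps_def)
  then show "suffix_bounded n X" using w suffix_bounded_subset by blast
next
  assume "suffix_bounded n X"
  then obtain B where B: "X \<subseteq> B" "suffix_bounded n B" "card B = n"
    using suffix_bounded_extend by blast
  then have sub: "B \<subseteq> {1..2 * n}" by (simp add: suffix_bounded_def)
  then obtain w where w: "set w \<subseteq> {(1, 1), (1, -1)}" "length w = 2 * n" "up_steps w = B"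
    using ex_path_up_steps by blast
  have "k \<le> 2 * card (B \<inter> {1..k})" if "k \<le> 2 * n" for k
  proof -
    have "card B = card (B \<inter> {1..k}) + card (B \<inter> {k<..})"
      using sub by (intro card_split) (auto intro: finite_subset)
    moreover have "2 * card (B \<inter> {k<..}) \<le> 2 * n - k"
      using B(2) that by (simp add: suffix_bounded_def)
    ultimately show ?thesis using B(3) that by linarith
  qed
  then have "dyck_path n w" using w B(3) by (simp add: dyck_path_iff)
  then show "catalan_indep n X" using w B(1) by (auto simp: catalan_indep_def)
qed

lemma matroid_catalan_indep: "matroid {1..2 * n} (catalan_indep n)"
proof
  show "X \<subseteq> {1..2 * n}" if "catalan_indep n X" for X
    using that by (simp add: catalan_indep_iff suffix_bounded_def)
  show "catalan_indep n {}"
    by (simp add: catalan_indep_iff suffix_bounded_def)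
qed (auto simp: catalan_indep_iff intro: suffix_bounded_subset suffix_bounded_augment)

lemma basis_catalan_iff:
  "matroid.basis (catalan_indep n) B \<longleftrightarrow> (\<exists>w. dyck_path n w \<and> up_steps w = B)"
proof -
  interpret matroid "{1..2 * n}" "catalan_indep n" by (rule matroid_catalan_indep)
  show ?thesis
  proof
    assume B: "basis B"
    then obtain w where "dyck_path n w" "B \<subseteq> up_steps w"
      by (auto simp: basis_def catalan_indep_def)
    moreover from this have "catalan_indep n (up_steps w)"
      unfolding catalan_indep_def by blast
    ultimately show "\<exists>w. dyck_path n w \<and> up_steps w = B"
      using B unfolding basis_def by blast
  next
    assume "\<exists>w. dyck_path n w \<and> up_steps w = B"
    then obtain w where w: "dyck_path n w" "up_steps w = B" by blast
    have "X = B" if X: "catalan_indep n X" "B \<subseteq> X" for X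
    proof -
      obtain u where u: "dyck_path n u" "X \<subseteq> up_steps u"
        using X unfolding catalan_indep_def by blast
      have "B = up_steps u"
        using w u X finite_up_steps[of u] by (intro card_subset_eq) (auto simp: dyck_path_iff)
      then show ?thesis using u X by blast
    qed
    then show "basis B" using w unfolding basis_def catalan_indep_def by blast
  qed
qed

end

theory Submission
  imports Defs
begin

text \<open>The identity map is an isomorphism. Columns with index greater than \<open>k\<close> vanish in the first
  \<open>\<lceil>k/2\<rceil>\<close> rows, so at most \<open>n - \<lceil>k/2\<rceil>\<close> of them are independent: independent sets satisfy the
  suffix condition of the Catalan matroid. Conversely, if \<open>b\<^sub>1 < \<dots> < b\<^sub>n\<close> is the up-step set of a
  Dyck path, then \<open>b\<^sub>i \<le> 2 i - 1\<close>, so the diagonal of the submatrix with these columns contributes a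
  nonvanishing term to the Leibniz expansion of its determinant. If the determinant were zero, the
  terms of even and of odd permutations would be two different families of squarefree monomials
  with the same sum, contrary to genericity.\<close>

text \<open>The map \<open>e\<close> labels the positions of \<open>M\<close> by indices of the
  collection; a label outside \<open>K\<close> marks a forced zero. Since \<open>e\<close> is
  injective, a Leibniz term determines its permutation, so no two terms share a monomial, and
  \<open>p\<close> guarantees that at least one term survives.\<close>

lemma det_nonzero_if_generic:
  fixes M :: "real mat" and e :: "nat \<Rightarrow> nat \<Rightarrow> 'i"
  assumes M: "M \<in> carrier_mat n n"
    and gen: "generic K x"
    and inj: "inj_on (\<lambda>(i, j). e i j) ({0..<n} \<times> {0..<n})"
    and supp: "\<And>i j. i < n \<Longrightarrow> j < n \<Longrightarrow> M $$ (i, j) = (if e i j \<in> K then x (e i j) else 0)"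
    and p: "p permutes {0..<n}" "\<And>i. i < n \<Longrightarrow> e i (p i) \<in> K"
  shows "det M \<noteq> 0"
proof
  assume det0: "det M = 0"
  \<comment> \<open>\<open>P\<close> keeps the permutations whose term avoids all forced zeros;
    \<open>S q\<close> collects the labels of the factors of that term.\<close>
  define P where "P = {q. q permutes {0..<n} \<and> (\<forall>i<n. e i (q i) \<in> K)}"
  define S where "S q = (\<lambda>i. e i (q i)) ` {0..<n}" for q
  define w where "w T = (\<Prod>i\<in>T. x i)" for T
  have finP: "finite P"
    by (rule finite_subset[OF _ finite_permutations[of "{0..<n}"]]) (auto simp: P_def)
  have perm: "q i < n" if "q permutes {0..<n}" "i < n" for q i
    using permutes_in_image[OF that(1), of i] that(2) by simp
  have eqD: "i = i' \<and> j = j'" if "e i j = e i' j'" "i < n" "j < n" "i' < n" "j' < n" for i j i' j'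
    using inj_onD[OF inj, of "(i, j)" "(i', j')"] that by auto
  \<comment> \<open>Each label in \<open>S q\<close> reveals its row and its column, so the set of
    labels determines \<open>q\<close>.\<close>
  have injS: "inj_on S P"
  proof (rule inj_onI)
    fix q r assume q: "q \<in> P" and r: "r \<in> P" and eq: "S q = S r"
    show "q = r"
    proof
      fix i
      show "q i = r i"
      proof (cases "i < n")
        case True
        then have "e i (q i) \<in> S r" unfolding eq[symmetric] by (simp add: S_def)
        then obtain k where "k < n" "e i (q i) = e k (r k)" by (auto simp: S_def)
        then show ?thesis using eqD[of i "q i" k "r k"] perm q r True by (auto simp: P_def)
      next
        case False
        then show ?thesis using q r by (auto simp: P_def permutes_not_in)
      qed
    qed
  qed
  have monomial: "(\<Prod>i = 0..<n. M $$ (i, q i)) = w (S q)" if "q \<in> P" for q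
  proof -
    have q: "q permutes {0..<n}" "\<And>i. i < n \<Longrightarrow> e i (q i) \<in> K" using that by (auto simp: P_def)
    \<comment> \<open>Factors from different rows have different labels, so passing to the set
      \<open>S q\<close> loses no factor: the monomial is squarefree.\<close>
    have "inj_on (\<lambda>i. e i (q i)) {0..<n}"
    proof (rule inj_onI)
      fix i k assume "i \<in> {0..<n}" "k \<in> {0..<n}" "e i (q i) = e k (q k)"
      then show "i = k" using eqD[of i "q i" k "q k"] perm[OF q(1)] by simp
    qed
    then have "w (S q) = (\<Prod>i = 0..<n. x (e i (q i)))"
      by (simp add: w_def S_def prod.reindex)
    also have "\<dots> = (\<Prod>i = 0..<n. M $$ (i, q i))"
      using supp perm[OF q(1)] q(2) by (intro prod.cong) auto
    finally show ?thesis by simp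
  qed
  define Ev where "Ev = {q \<in> P. evenperm q}"
  define Od where "Od = {q \<in> P. \<not> evenperm q}"
  have fin: "finite Ev" "finite Od" using finP by (auto simp: Ev_def Od_def)
  have "det M = (\<Sum>q | q permutes {0..<n}. signof q * (\<Prod>i = 0..<n. M $$ (i, q i)))"
    by (rule det_def'[OF M])
  also have "\<dots> = (\<Sum>q\<in>P. signof q * (\<Prod>i = 0..<n. M $$ (i, q i)))"
  proof (rule sum.mono_neutral_right)
    show "finite {q. q permutes {0..<n}}" by (rule finite_permutations) simp
    show "P \<subseteq> {q. q permutes {0..<n}}" by (auto simp: P_def)
    show "\<forall>q\<in>{q. q permutes {0..<n}} - P. signof q * (\<Prod>i = 0..<n. M $$ (i, q i)) = 0"
    proof
      fix q assume "q \<in> {q. q permutes {0..<n}} - P"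
      then obtain i where "i < n" "M $$ (i, q i) = 0"
        using supp perm unfolding P_def by auto
      then have "(\<Prod>i = 0..<n. M $$ (i, q i)) = 0" by (intro prod_zero) auto
      then show "signof q * (\<Prod>i = 0..<n. M $$ (i, q i)) = 0" by simp
    qed
  qed
  also have "\<dots> = (\<Sum>q\<in>P. signof q * w (S q))"
    using monomial by (intro sum.cong) auto
  also have "\<dots> = (\<Sum>q\<in>Ev. signof q * w (S q)) + (\<Sum>q\<in>Od. signof q * w (S q))"
  proof -
    have "P = Ev \<union> Od" "Ev \<inter> Od = {}" by (auto simp: Ev_def Od_def)
    then show ?thesis using fin by (simp add: sum.union_disjoint)
  qed
  also have "\<dots> = (\<Sum>q\<in>Ev. w (S q)) - (\<Sum>q\<in>Od. w (S q))"
    by (simp add: Ev_def Od_def sign_def sum_negf)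
  also have "(\<Sum>q\<in>Ev. w (S q)) = (\<Sum>T\<in>S ` Ev. w T)"
    by (simp add: sum.reindex[OF inj_on_subset[OF injS]] Ev_def)
  also have "(\<Sum>q\<in>Od. w (S q)) = (\<Sum>T\<in>S ` Od. w T)"
    by (simp add: sum.reindex[OF inj_on_subset[OF injS]] Od_def)
  finally have "(\<Sum>T\<in>S ` Ev. w T) = (\<Sum>T\<in>S ` Od. w T)" using det0 by simp
  moreover have "S ` Ev \<in> Pow (Pow K)" "S ` Od \<in> Pow (Pow K)"
    by (auto simp: Ev_def Od_def P_def S_def)
  ultimately have eq: "S ` Ev = S ` Od"
    using gen unfolding generic_def w_def by (meson inj_onD)
  \<comment> \<open>As \<open>S\<close> is injective on \<open>P\<close>, the images of the disjoint
    sets \<open>Ev\<close> and \<open>Od\<close> are disjoint; being equal, they are empty.\<close>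
  have "Ev \<inter> Od = {}" "Ev \<subseteq> P" "Od \<subseteq> P" by (auto simp: Ev_def Od_def)
  then have "S ` Ev \<inter> S ` Od = {}" using inj_on_image_Int[OF injS, of Ev Od] by simp
  then have "Ev = {}" "Od = {}" using eq by auto
  moreover have "p \<in> Ev \<union> Od" using p by (auto simp: Ev_def Od_def P_def)
  ultimately show False by simp
qed

context vec_space
begin

lemma in_span_unit_vecs_if_zero_prefix:
  assumes v: "v \<in> carrier_vec n" and zero: "\<And>i. i < m \<Longrightarrow> i < n \<Longrightarrow> v $ i = 0"
  shows "v \<in> span (unit_vec n ` {m..<n})"
proof (rule in_spanI)
  let ?U = "unit_vec n ` {m..<n} :: 'a vec set"
  \<comment> \<open>Coefficients in \<open>lincomb\<close> are attached to vectors, so the index of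
    a unit vector has to be recovered from the vector.\<close>
  define a where "a u = v $ (THE i. u = unit_vec n i)" for u :: "'a vec"
  have a: "a (unit_vec n i) = v $ i" if "i < n" for i
    using that unfolding a_def by (auto simp: unit_vec_eq)
  have U: "?U \<subseteq> carrier_vec n" by auto
  have inj: "inj_on (unit_vec n :: nat \<Rightarrow> 'a vec) {m..<n}"
    by (rule inj_onI) (simp add: unit_vec_eq)
  show "v = lincomb a ?U"
  proof (rule eq_vecI)
    show "dim_vec v = dim_vec (lincomb a ?U)" using v lincomb_dim[OF _ U] by simp
    fix i assume "i < dim_vec (lincomb a ?U)"
    then have i: "i < n" using lincomb_dim[OF _ U] by simp
    have "lincomb a ?U $ i = (\<Sum>u\<in>?U. a u * u $ i)" by (rule lincomb_index[OF i U])
    also have "\<dots> = (\<Sum>k = m..<n. a (unit_vec n k) * unit_vec n k $ i)"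
      by (simp add: sum.reindex[OF inj])
    also have "\<dots> = (\<Sum>k = m..<n. if k = i then v $ i else 0)"
      using i a by (intro sum.cong) auto
    also have "\<dots> = v $ i" using zero[of i] i by (auto simp: sum.delta)
    finally show "v $ i = lincomb a ?U $ i" by simp
  qed
qed auto

text \<open>Steinitz exchange: \<open>S\<close> lies in the span of the unit vectors with index in
  \<open>{m..<n}\<close>.\<close>

lemma card_lin_indpt_zero_prefix:
  assumes S: "finite S" "S \<subseteq> carrier_vec n" "lin_indpt S"
    and zero: "\<And>v i. v \<in> S \<Longrightarrow> i < m \<Longrightarrow> i < n \<Longrightarrow> v $ i = 0"
  shows "card S \<le> n - m"
proof -
  let ?U = "unit_vec n ` {m..<n} :: 'a vec set"
  have "S \<subseteq> span ?U"
    using in_span_unit_vecs_if_zero_prefix S(2) zero by (meson subsetD subsetI)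
  then have "card S \<le> card ?U" using replacement[of S ?U] S by force
  also have "\<dots> \<le> n - m" using card_image_le[of "{m..<n}" "unit_vec n :: nat \<Rightarrow> 'a vec"] by simp
  finally show ?thesis .
qed

end

text \<open>A nonzero determinant excludes both repeated and linearly dependent columns, which are
  the two ways in which \<open>vector_indep\<close> can fail.\<close>

lemma vector_indep_if_det_nonzero:
  fixes v :: "'i \<Rightarrow> 'k :: field vec"
  assumes "c ` {0..<n} \<subseteq> E" and v: "v ` E \<subseteq> carrier_vec n"
    and det: "det (mat n n (\<lambda>(i, j). v (c j) $ i)) \<noteq> 0"
  shows "vector_indep n E v (c ` {0..<n})"
proof -
  interpret vec_space "TYPE('k)" n .
  let ?M = "mat n n (\<lambda>(i, j). v (c j) $ i)"
  have M: "?M \<in> carrier_mat n n" by simp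
  have col: "col ?M j = v (c j)" if "j < n" for j
  proof -
    have "c j \<in> E" using that assms(1) by auto
    then have "v (c j) \<in> carrier_vec n" using v by auto
    then show ?thesis using that by (auto simp: col_def)
  qed
  have "inj_on v (c ` {0..<n})"
  proof (rule inj_onI)
    fix a b assume "a \<in> c ` {0..<n}" "b \<in> c ` {0..<n}" and eq: "v a = v b"
    then obtain i j where ij: "i < n" "j < n" "a = c i" "b = c j" by auto
    then have "col ?M i = col ?M j" using eq col by simp
    then show "a = b" using det_identical_columns[OF M _ ij(1,2)] det ij by blast
  qed
  moreover have "set (cols ?M) = v ` c ` {0..<n}"
    using col by (auto simp: cols_def image_image)
  then have "lin_indpt (v ` c ` {0..<n})"
    using lin_dep_cols_imp_det_0[OF M] det by auto
  ultimately show ?thesis using assms(1) by (simp add: vector_indep_def)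
qed

text \<open>Otherwise the \<open>n - i\<close> elements from position \<open>i\<close> on all exceed
  \<open>2 * i + 1\<close>, while the suffix condition forces twice their number to be at most
  \<open>2 * n - 2 * i - 1\<close>. Positions count from 0.\<close>

lemma suffix_bounded_sorted_nth_le:
  assumes B: "suffix_bounded n B" "card B = n" and i: "i < n"
  shows "sorted_list_of_set B ! i \<le> 2 * i + 1"
proof (rule ccontr)
  let ?b = "\<lambda>j. sorted_list_of_set B ! j"
  assume "\<not> ?thesis"
  then have gt: "2 * i + 1 < ?b i" by simp
  have fin: "finite B" using B(1) by (auto simp: suffix_bounded_def intro: finite_subset)
  have less: "?b j < ?b k" if "j < k" "k < n" for j k
    by (rule sorted_wrt_nth_less[of "(<)"]) (use that B(2) fin in auto)
  have inB: "?b j \<in> B" if "j < n" for j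
    using nth_mem[of j "sorted_list_of_set B"] that B(2) fin by simp
  have "inj_on ?b {i..<n}"
    by (rule inj_onI) (metis atLeastLessThan_iff less less_irrefl linorder_neqE_nat)
  then have "n - i = card (?b ` {i..<n})" by (simp add: card_image)
  also have "\<dots> \<le> card (B \<inter> {2 * i + 1<..})"
  proof (rule card_mono)
    have "2 * i + 1 < ?b j" if "i \<le> j" "j < n" for j
      using gt less[of i j] that by (cases "i = j") auto
    then show "?b ` {i..<n} \<subseteq> B \<inter> {2 * i + 1<..}" using inB by auto
  qed (use fin in simp)
  finally have "n - i \<le> card (B \<inter> {2 * i + 1<..})" .
  moreover have "2 * card (B \<inter> {2 * i + 1<..}) \<le> 2 * n - (2 * i + 1)"
    using B(1) i unfolding suffix_bounded_def by (auto dest!: spec[of _ "2 * i + 1"])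
  ultimately show False using i by linarith
qed

theorem theorem5p1:
  fixes n :: nat and A :: "int mat"
  assumes "n > 0"
    and "A \<in> carrier_mat n (2 * n)"
    and "generic {(i, j). i \<in> {1..n} \<and> j \<in> {1..2 * i - 1}}
           (\<lambda>(i, j). real_of_int (A $$ (i - 1, j - 1)))"
    and "\<And>i j. i \<in> {1..n} \<Longrightarrow> j \<in> {1..2 * n} \<Longrightarrow> j \<notin> {1..2 * i - 1} \<Longrightarrow>
           A $$ (i - 1, j - 1) = 0"
  shows "matroids_isomorphic
           {1..2 * n} (vector_indep n {1..2 * n} (\<lambda>j. map_vec rat_of_int (col A (j - 1))))
           {1..2 * n} (catalan_indep n)"
proof -
  define E where "E = {1..2 * n}"
  define v where "v j = map_vec rat_of_int (col A (j - 1))" for j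
  have finE: "finite E" and vE: "v ` E \<subseteq> carrier_vec n"
    using assms(2) by (auto simp: E_def v_def)
  have v_index: "v j $ i = of_int (A $$ (i, j - 1))" if "i < n" "j \<in> E" for i j
    using that assms(2) by (auto simp: v_def E_def)
  \<comment> \<open>Row \<open>i\<close> counted from 0 is row \<open>i + 1\<close> of the
    statement, whose generic entries end at column \<open>2 * i + 1\<close>.\<close>
  have A_zero: "A $$ (i, j - 1) = 0" if "i < n" "j \<in> E" "2 * i + 1 < j" for i j
    using assms(4)[of "Suc i" j] that by (simp add: E_def)
  interpret V: matroid E "vector_indep n E v" by (rule matroid_vector_indep[OF finE vE])
  interpret C: matroid E "catalan_indep n" unfolding E_def by (rule matroid_catalan_indep)
  interpret vec_space "TYPE(rat)" n .
  have "suffix_bounded n X" if X: "vector_indep n E v X" for X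
    unfolding suffix_bounded_def
  proof (intro conjI allI impI)
    show "X \<subseteq> {1..2 * n}" using X by (simp add: vector_indep_def E_def)
    fix k assume k: "k \<le> 2 * n"
    let ?Y = "X \<inter> {k<..}"
    have Y: "vector_indep n E v ?Y" using V.indep_subset[OF X] by simp
    then have YE: "?Y \<subseteq> E" and inj: "inj_on v ?Y" and li: "lin_indpt (v ` ?Y)"
      by (simp_all add: vector_indep_def)
    \<comment> \<open>If \<open>i < (k + 1) div 2\<close>, then \<open>2 * i + 1 \<le> k\<close>, so
      every column beyond \<open>k\<close> vanishes in row \<open>i\<close>.\<close>
    have "card (v ` ?Y) \<le> n - (k + 1) div 2"
    proof (rule card_lin_indpt_zero_prefix)
      show "finite (v ` ?Y)" using YE finE finite_subset by blast
      show "v ` ?Y \<subseteq> carrier_vec n" using YE vE by blast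
      show "lin_indpt (v ` ?Y)" by (rule li)
      fix u i assume "u \<in> v ` ?Y" and i: "i < (k + 1) div 2" "i < n"
      then obtain j where j: "u = v j" "j \<in> ?Y" by blast
      then show "u $ i = 0" using v_index[of i j] A_zero[of i j] i YE by auto
    qed
    then show "2 * card ?Y \<le> 2 * n - k" using k by (simp add: card_image[OF inj])
  qed
  moreover have "vector_indep n E v X" if X: "suffix_bounded n X" for X
  proof -
    \<comment> \<open>Independence passes to subsets, so it suffices to treat a set of
      \<open>n\<close> columns, which gives a square submatrix.\<close>
    obtain B where XB: "X \<subseteq> B" and B: "suffix_bounded n B" "card B = n"
      using suffix_bounded_extend[OF X] by blast
    have BE: "B \<subseteq> E" using B(1) by (simp add: suffix_bounded_def E_def)
    then have finB: "finite B" using finE finite_subset by blast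
    let ?b = "\<lambda>j. sorted_list_of_set B ! j"
    have img: "?b ` {0..<n} = B"
      using finB B(2) by (metis length_sorted_list_of_set nth_image
          set_sorted_list_of_set take_all_iff order_refl atLeast0LessThan list.set_map map_nth set_upt)
    have inj_b: "i = j" if "?b i = ?b j" "i < n" "j < n" for i j
      using that finB B(2) nth_eq_iff_index_eq[of "sorted_list_of_set B" i j] by simp
    have bE: "?b j \<in> E" if "j < n" for j using that img BE by fastforce
    \<comment> \<open>An integer matrix lets the nonvanishing of the determinant pass from the
      reals, where genericity lives, to the rationals.\<close>
    define M where "M = mat n n (\<lambda>(i, j). A $$ (i, ?b j - 1))"
    let ?K = "{(i, j). i \<in> {1..n} \<and> j \<in> {1..2 * i - 1}}"
    have "det (map_mat real_of_int M) \<noteq> 0"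
    \<comment> \<open>The label of an entry is its position in \<open>A\<close> counted from 1; the
      surviving term is the diagonal one, by the bound on the sorted elements of
      \<open>B\<close>.\<close>
    proof (rule det_nonzero_if_generic[OF _ assms(3), where e = "\<lambda>i j. (Suc i, ?b j)" and p = id])
      show "inj_on (\<lambda>(i, j). (Suc i, ?b j)) ({0..<n} \<times> {0..<n})"
        using inj_b by (auto intro!: inj_onI)
      show "map_mat real_of_int M $$ (i, j) = (if (Suc i, ?b j) \<in> ?K
          then (case (Suc i, ?b j) of (i, j) \<Rightarrow> real_of_int (A $$ (i - 1, j - 1))) else 0)"
        if "i < n" "j < n" for i j
        using that bE[of j] A_zero[of i "?b j"] by (auto simp: M_def E_def)
      show "(Suc i, ?b (id i)) \<in> ?K" if "i < n" for i
        using suffix_bounded_sorted_nth_le[OF B that] bE[OF that] that by (auto simp: E_def)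
    qed (auto simp: M_def permutes_id)
    then have "det M \<noteq> 0" by (simp add: of_int_hom.hom_det)
    then have "det (map_mat rat_of_int M) \<noteq> 0" by (simp add: of_int_hom.hom_det)
    also have "map_mat rat_of_int M = mat n n (\<lambda>(i, j). v (?b j) $ i)"
      using v_index bE by (intro eq_matI) (auto simp: M_def)
    finally have "vector_indep n E v (?b ` {0..<n})"
      using vector_indep_if_det_nonzero[OF _ vE, of ?b] img BE by blast
    then show ?thesis using V.indep_subset XB img by simp
  qed
  ultimately have iff: "vector_indep n E v X \<longleftrightarrow> catalan_indep n X" for X
    by (auto simp: catalan_indep_iff)
  have "matroid_isomorphism E (vector_indep n E v) E (catalan_indep n) id"
    by unfold_locales (simp_all add: iff)
  then show ?thesis unfolding matroids_isomorphic_def E_def v_def by blast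
qed

end
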